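(* Let $J$ be a non-empty countable set, let $(p_j)_{j\in J}$ be a probability distribution on $J$ (that is, $p_j$ is the probability that the random index equals $j$), and for each $j\in J$ let scale factors $r_i^{(j)}\in(0,1)$ and weights $m_i^{(j)}$, $i=1,\dots,N_j$, be as in the context. Assume: (A1) $\sup_{j\in J}N_j<\infty$; (A2) $\inf_{j\in J}\min_{i=1,\dots,N_j}r_i^{(j)}m_i^{(j)}>0$; (A3) $\sup_{j\in J}\max_{i=1,\dots,N_j}r_i^{(j)}m_i^{(j)}<1$; (A4) $\prod_{j\in J:\ \sum_{i=1}^{N_j}r_i^{(j)}m_i^{(j)}<1}\ \sum_{i=1}^{N_j}r_i^{(j)}m_i^{(j)}>0$; (A5) $\prod_{j\in J:\ \sum_{i=1}^{N_j}r_i^{(j)}m_i^{(j)}>1}\ \sum_{i=1}^{N_j}r_i^{(j)}m_i^{(j)}<\infty$. Let $\gamma_h>0$ be the unique solution of $$\prod_{j\in J}\left(\sum_{i=1}^{N_j}\left(r_i^{(j)}m_i^{(j)}\right)^{\gamma_h}\right)^{p_j}=1$$ and let $\gamma_r>0$ be the unique solution of $$\mathbb E\left(\sum_{i=1}^{N_U}\left(r_i^{(U)}m_i^{(U)}\right)^{\gamma_r}\right)=1,$$ where $U$ is a $J$-valued random variable with $\mathbb P(U=j)=p_j$, $j\in J$. Then $\gamma_h\le\gamma_r$, and equality holds if and only if there exists $\alpha>0$ such that $$\sum_{i=1}^{N_j}\left(r_i^{(j)}m_i^{(j)}\right)^{\alpha}=1\quad\text{for all }j\in J .$$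
   Context: Fix $-\infty<a<b<\infty$. For each $j\in J$: $N_j\in\mathbb N$, $N_j\ge2$; $S_i^{(j)}(x)=r_i^{(j)}x+c_i^{(j)}$ ($i=1,\dots,N_j$), with $r_i^{(j)}\in(0,1)$, $c_i^{(j)}\in\mathbb R$, satisfy $a=S_1^{(j)}(a)<S_1^{(j)}(b)\le S_2^{(j)}(a)<\cdots<S_{N_j}^{(j)}(b)=b$; and $m^{(j)}=(m_1^{(j)},\dots,m_{N_j}^{(j)})$ is a vector of weights, i.e. $m_i^{(j)}\in(0,1)$, $\sum_{i=1}^{N_j}m_i^{(j)}=1$. Empty products equal $1$. Here $\gamma_h$ is the spectral exponent of Krein-Feller operators for random homogeneous Cantor measures (one random index per level, the indices being i.i.d. with distribution $(p_j)$) and $\gamma_r$ the one for random recursive Cantor measures (an independent random index with distribution $(p_j)$ per node of the tree), but the statement only involves the defining equations.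
   Formalization: The equality criterion is required only for those j in J with p_j > 0, since indices with p_j = 0 affect neither equation and "only if" fails for all j in J otherwise; if all p_j > 0 it is the stated criterion. *)

theory Defs
  imports "HOL-Probability.Probability"
begin

text \<open>Unordered infinite product: the limit of the net of finite partial products, the
  multiplicative analogue of \<^const>\<open>has_sum\<close>. (The library's \<open>has_prod\<close>
  is for sequences only.) The limit \<open>0\<close> is allowed.\<close>

definition has_unordered_prod :: "('a \<Rightarrow> real) \<Rightarrow> real \<Rightarrow> 'a set \<Rightarrow> bool" where
  "has_unordered_prod f x A \<longleftrightarrow> (prod f \<longlongrightarrow> x) (finite_subsets_at_top A)"

definition cantor_ifs ::
  "real \<Rightarrow> real \<Rightarrow> nat \<Rightarrow> (nat \<Rightarrow> real) \<Rightarrow> (nat \<Rightarrow> real) \<Rightarrow> bool" where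
  "cantor_ifs a b N r c \<longleftrightarrow>
     (let S = (\<lambda>i x. r i * x + c i) in
       N \<ge> 2 \<and> (\<forall>i\<in>{1..N}. 0 < r i \<and> r i < 1) \<and>
       S 1 a = a \<and> S N b = b \<and>
       (\<forall>i\<in>{1..N}. S i a < S i b) \<and>
       (\<forall>i\<in>{1..<N}. S i b \<le> S (Suc i) a))"

definition weight_vector :: "nat \<Rightarrow> (nat \<Rightarrow> real) \<Rightarrow> bool" where
  "weight_vector N m \<longleftrightarrow>
     (\<forall>i\<in>{1..N}. 0 < m i \<and> m i < 1) \<and> (\<Sum>i=1..N. m i) = 1"

definition power_sum ::
  "('j \<Rightarrow> nat) \<Rightarrow> ('j \<Rightarrow> nat \<Rightarrow> real) \<Rightarrow> ('j \<Rightarrow> nat \<Rightarrow> real) \<Rightarrow> real \<Rightarrow> 'j \<Rightarrow> real" where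
  "power_sum N r m s j = (\<Sum>i=1..N j. (r j i * m j i) powr s)"

definition homogeneous_eq ::
  "'j set \<Rightarrow> ('j \<Rightarrow> real) \<Rightarrow> ('j \<Rightarrow> nat) \<Rightarrow> ('j \<Rightarrow> nat \<Rightarrow> real) \<Rightarrow> ('j \<Rightarrow> nat \<Rightarrow> real)
    \<Rightarrow> real \<Rightarrow> bool" where
  "homogeneous_eq J p N r m s \<longleftrightarrow> has_unordered_prod (\<lambda>j. power_sum N r m s j powr p j) 1 J"

definition recursive_eq ::
  "'w measure \<Rightarrow> ('w \<Rightarrow> 'j) \<Rightarrow> ('j \<Rightarrow> nat) \<Rightarrow> ('j \<Rightarrow> nat \<Rightarrow> real) \<Rightarrow> ('j \<Rightarrow> nat \<Rightarrow> real)
    \<Rightarrow> real \<Rightarrow> bool" where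
  "recursive_eq M U N r m s \<longleftrightarrow> prob_space.expectation M (\<lambda>\<omega>. power_sum N r m s (U \<omega>)) = 1"

text \<open>Both exponents are definite descriptions, meaningful only once the corresponding equation
  is known to have exactly one positive solution.\<close>

definition gamma_h ::
  "'j set \<Rightarrow> ('j \<Rightarrow> real) \<Rightarrow> ('j \<Rightarrow> nat) \<Rightarrow> ('j \<Rightarrow> nat \<Rightarrow> real) \<Rightarrow> ('j \<Rightarrow> nat \<Rightarrow> real) \<Rightarrow> real" where
  "gamma_h J p N r m = (THE s. 0 < s \<and> homogeneous_eq J p N r m s)"

definition gamma_r ::
  "'w measure \<Rightarrow> ('w \<Rightarrow> 'j) \<Rightarrow> ('j \<Rightarrow> nat) \<Rightarrow> ('j \<Rightarrow> nat \<Rightarrow> real) \<Rightarrow> ('j \<Rightarrow> nat \<Rightarrow> real) \<Rightarrow> real" where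
  "gamma_r M U N r m = (THE s. 0 < s \<and> recursive_eq M U N r m s)"

end

theory Submission
  imports Defs
begin

text \<open>The idea is to pass to logarithms. If all products \<open>r m\<close> lie in
  \<open>[\<epsilon>, \<delta>]\<close> with \<open>0 < \<epsilon>\<close> and \<open>\<delta> < 1\<close>, then
  \<open>\<epsilon>\<^sup>u S\<^sub>j(s) \<le> S\<^sub>j(s + u) \<le> \<delta>\<^sup>u S\<^sub>j(s)\<close> for the power sums
  \<open>S\<^sub>j\<close>. Hence both \<open>F(s) = \<Sum> p\<^sub>j ln (S\<^sub>j(s))\<close> and
  \<open>ln (G(s))\<close>, where \<open>G(s) = \<Sum> p\<^sub>j S\<^sub>j(s)\<close>, have all difference quotients in
  \<open>[ln \<epsilon>, ln \<delta>]\<close>, and each has exactly one zero because it is positive at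
  \<open>0\<close>. The inequality \<open>ln x \<le> x - 1\<close>, strict unless \<open>x = 1\<close>, gives
  \<open>F \<le> G - 1\<close>, hence the comparison of the zeros and its equality case.\<close>

section \<open>Analytic tools: roots from slope bounds, products, expectations\<close>

text \<open>Two-sided slope bounds make \<open>f\<close> Lipschitz, hence continuous, and the
  negative upper slope makes it strictly decreasing and eventually nonpositive; the intermediate
  value theorem does the rest.\<close>

lemma unique_positive_root:
  fixes f :: "real \<Rightarrow> real"
  assumes slope: "\<And>s t. 0 \<le> s \<Longrightarrow> s \<le> t \<Longrightarrow> L * (t - s) \<le> f t - f s \<and> f t - f s \<le> l * (t - s)"
    and "l < 0" and "0 < f 0"
  shows "\<exists>!s. 0 < s \<and> f s = 0"
proof -
  \<comment> \<open>As \<open>l\<close> is negative, \<open>f t - f s\<close> is nonpositive, so the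
    lower slope alone controls its absolute value.\<close>
  have lip: "\<bar>f t - f s\<bar> \<le> \<bar>L\<bar> * \<bar>t - s\<bar>" if "0 \<le> s" "s \<le> t" for s t
  proof -
    have "f t - f s \<le> 0"
      using slope[OF that] \<open>l < 0\<close> that mult_nonpos_nonneg[of l "t - s"] by simp
    moreover have "L * (t - s) \<ge> - (\<bar>L\<bar> * (t - s))"
      using abs_ge_minus_self[of "L * (t - s)"] that by (simp add: abs_mult)
    ultimately show ?thesis using slope[OF that] that by simp
  qed
  have "\<bar>L\<bar>-lipschitz_on {0..} f"
  proof (rule lipschitz_onI)
    fix x y :: real assume "x \<in> {0..}" "y \<in> {0..}"
    then show "dist (f x) (f y) \<le> \<bar>L\<bar> * dist x y"
      using lip[of x y] lip[of y x] by (cases "x \<le> y") (auto simp: dist_real_def abs_minus_commute)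
  qed simp
  then have cont: "continuous_on {0..} f"
    by (rule lipschitz_on_continuous_on)
  \<comment> \<open>The line through \<open>(0, f 0)\<close> with slope \<open>l\<close> lies above
    the graph of \<open>f\<close> and meets the axis at \<open>T\<close>.\<close>
  define T where "T = f 0 / (- l)"
  have "T > 0" using assms by (simp add: T_def divide_pos_neg)
  have "f T \<le> 0"
    using slope[of 0 T] \<open>T > 0\<close> \<open>l < 0\<close> by (simp add: T_def)
  then obtain s where s: "0 \<le> s" "s \<le> T" "f s = 0"
    using IVT2'[of f T 0 0] \<open>0 < f 0\<close> \<open>T > 0\<close> continuous_on_subset[OF cont, of "{0..T}"] by auto
  have dec: "f t < f s" if "0 \<le> s" "s < t" for s t
    using slope[of s t] that \<open>l < 0\<close> mult_neg_pos[of l "t - s"] by simp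
  show ?thesis
  proof (rule ex1I)
    show "0 < s \<and> f s = 0" using s \<open>0 < f 0\<close> by (cases "s = 0") auto
    fix t assume "0 < t \<and> f t = 0"
    then show "t = s" using dec[of s t] dec[of t s] s by (cases t s rule: linorder_cases) auto
  qed
qed

text \<open>Continuity of \<open>exp\<close> carries the net of finite partial sums to the net of
  finite partial products, whose limit is therefore \<open>exp S\<close>; limits along this
  nontrivial filter are unique.\<close>

lemma has_unordered_prod_exp_iff:
  assumes "(f has_sum S) A"
  shows "has_unordered_prod (\<lambda>j. exp (f j)) 1 A \<longleftrightarrow> S = 0"
proof -
  have "((\<lambda>F. exp (sum f F)) \<longlongrightarrow> exp S) (finite_subsets_at_top A)"
    using assms unfolding has_sum_def by (rule tendsto_exp)
  moreover have "\<forall>\<^sub>F F in finite_subsets_at_top A. exp (sum f F) = prod (\<lambda>j. exp (f j)) F"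
    by (rule eventually_finite_subsets_at_top_weakI) (rule exp_sum)
  ultimately have "(prod (\<lambda>j. exp (f j)) \<longlongrightarrow> exp S) (finite_subsets_at_top A)"
    by (rule Lim_transform_eventually)
  then show ?thesis
    unfolding has_unordered_prod_def
    using tendsto_unique[OF finite_subsets_at_top_neq_bot] by fastforce
qed

text \<open>The law of \<open>U\<close> has density \<open>p\<close> with respect to counting
  measure, as both measures agree on singletons of a countable set. The expectation thus becomes a
  weighted sum.\<close>

lemma (in prob_space) has_sum_expectation_discrete:
  fixes f :: "'j \<Rightarrow> real"
  assumes "countable J" and U: "U \<in> measurable M (count_space J)"
    and p: "\<And>j. j \<in> J \<Longrightarrow> prob {\<omega> \<in> space M. U \<omega> = j} = p j"
    and summ: "(\<lambda>j. p j * f j) summable_on J"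
  shows "((\<lambda>j. p j * f j) has_sum expectation (\<lambda>\<omega>. f (U \<omega>))) J"
proof -
  have pn: "0 \<le> p j" if "j \<in> J" for j
    using p[OF that] measure_nonneg by metis
  have D: "distr M (count_space J) U = density (count_space J) p"
  proof (rule measure_eqI_countable)
    fix j assume "j \<in> J"
    have "emeasure (distr M (count_space J) U) {j} = emeasure M {\<omega> \<in> space M. U \<omega> = j}"
      using \<open>j \<in> J\<close> by (subst emeasure_distr[OF U]) (auto intro!: arg_cong[of _ _ "emeasure M"])
    also have "\<dots> = ennreal (p j)"
      using p[OF \<open>j \<in> J\<close>] by (simp add: emeasure_eq_measure)
    also have "\<dots> = emeasure (density (count_space J) p) {j}"
      using \<open>j \<in> J\<close> by (simp add: emeasure_density nn_integral_count_space_indicator[symmetric] nn_integral_count_space_finite)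
    finally show "emeasure (distr M (count_space J) U) {j} = emeasure (density (count_space J) p) {j}" .
  qed (use assms in auto)
  have "expectation (\<lambda>\<omega>. f (U \<omega>)) = integral\<^sup>L (distr M (count_space J) U) f"
    using U by (simp add: integral_distr)
  also have "\<dots> = (\<integral>j. p j * f j \<partial>count_space J)"
    unfolding D using pn by (subst integral_density) (auto simp: AE_count_space)
  also have "\<dots> = infsetsum (\<lambda>j. p j * f j) J"
    by (simp add: infsetsum_def)
  \<comment> \<open>The Lebesgue-type sum needs absolute summability, which for real families is
    equivalent to unconditional summability.\<close>
  also have "\<dots> = infsum (\<lambda>j. p j * f j) J"
    using summ[THEN summable_on_iff_abs_summable_on_real[THEN iffD1]]
    by (intro infsetsum_infsum abs_summable_equivalent[THEN iffD1])
  finally show ?thesis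
    using summ by simp
qed

text \<open>Turns multiplicative shift estimates into the slope bounds that
  \<open>unique_positive_root\<close> asks for.\<close>

lemma ln_slope:
  fixes x y e u :: real
  assumes "0 < x" "0 < y" "0 < e"
  shows "e powr u * x \<le> y \<Longrightarrow> ln e * u \<le> ln y - ln x"
    and "y \<le> e powr u * x \<Longrightarrow> ln y - ln x \<le> ln e * u"
proof -
  have eq: "ln (e powr u * x) = ln e * u + ln x"
    using assms by (simp add: ln_mult ln_powr)
  show "ln e * u \<le> ln y - ln x" if "e powr u * x \<le> y"
    using ln_mono[OF that] eq assms by simp
  show "ln y - ln x \<le> ln e * u" if "y \<le> e powr u * x"
    using ln_mono[OF that] eq assms by simp
qed

section \<open>Power sums under uniform bounds on ratios and branching numbers\<close>

locale bounded_system =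
  fixes J :: "'j set" and p :: "'j \<Rightarrow> real" and N :: "'j \<Rightarrow> nat"
    and r m :: "'j \<Rightarrow> nat \<Rightarrow> real" and \<epsilon> \<delta> :: real and K :: nat
  assumes p_nonneg: "j \<in> J \<Longrightarrow> 0 \<le> p j"
    and p_sum: "(p has_sum 1) J"
    and N_ge: "j \<in> J \<Longrightarrow> 2 \<le> N j"
    and N_le: "j \<in> J \<Longrightarrow> N j \<le> K"
    and \<epsilon>_pos: "0 < \<epsilon>" and \<delta>_less: "\<delta> < 1"
    and ratio_ge: "j \<in> J \<Longrightarrow> i \<in> {1..N j} \<Longrightarrow> \<epsilon> \<le> r j i * m j i"
    and ratio_le: "j \<in> J \<Longrightarrow> i \<in> {1..N j} \<Longrightarrow> r j i * m j i \<le> \<delta>"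
begin

abbreviation S :: "real \<Rightarrow> 'j \<Rightarrow> real" where
  "S \<equiv> power_sum N r m"

abbreviation mean :: "('j \<Rightarrow> real) \<Rightarrow> real" where
  "mean f \<equiv> (\<Sum>\<^sub>\<infinity>j\<in>J. p j * f j)"

lemma J_nonempty: "J \<noteq> {}"
  using infsumI[OF p_sum] by (rule contrapos_pn) simp

lemma ratio_pos: "0 < r j i * m j i" if "j \<in> J" "i \<in> {1..N j}"
  using less_le_trans[OF \<epsilon>_pos ratio_ge[OF that]] .

text \<open>Squeezing a single ratio between the two bounds transfers positivity to \<delta> and the
  bound by 1 to \<epsilon>.\<close>

lemma \<epsilon>_le_\<delta>: "\<epsilon> \<le> \<delta>"
proof -
  obtain j where j: "j \<in> J" using J_nonempty by blast
  then have "1 \<in> {1..N j}" using N_ge[OF j] by simp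
  then show ?thesis
    using ratio_ge[OF j] ratio_le[OF j] by (blast intro: order_trans)
qed

lemma \<delta>_pos: "0 < \<delta>" and \<epsilon>_less: "\<epsilon> < 1"
  using \<epsilon>_le_\<delta> \<epsilon>_pos \<delta>_less by auto

lemma S_zero: "S 0 j = real (N j)" if "j \<in> J"
proof -
  \<comment> \<open>Positivity of the ratios matters even at exponent 0, since
    \<open>0 powr 0 = 0\<close>.\<close>
  have "S 0 j = (\<Sum>i=1..N j. 1)"
    unfolding power_sum_def
    using ratio_pos[OF that, THEN less_imp_neq] by (intro sum.cong) auto
  then show ?thesis by simp
qed

lemma S_pos: "0 < S s j" if "j \<in> J"
  unfolding power_sum_def
proof (rule sum_pos)
  show "0 < (r j i * m j i) powr s" if "i \<in> {1..N j}" for i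
    unfolding powr_gt_zero using ratio_pos[OF \<open>j \<in> J\<close> that] by (rule less_imp_neq[symmetric])
qed (use N_ge[OF that] in auto)

text \<open>Raising the exponent by \<open>u\<close> multiplies each summand by its ratio to the
  power \<open>u\<close>, which lies between \<open>\<epsilon> powr u\<close> and
  \<open>\<delta> powr u\<close>.\<close>

lemma S_shift:
  assumes "j \<in> J" "0 \<le> u"
  shows "\<epsilon> powr u * S s j \<le> S (s + u) j" and "S (s + u) j \<le> \<delta> powr u * S s j"
proof -
  show "\<epsilon> powr u * S s j \<le> S (s + u) j"
    unfolding power_sum_def sum_distrib_left
  proof (rule sum_mono)
    fix i assume "i \<in> {1..N j}"
    then have "\<epsilon> powr u \<le> (r j i * m j i) powr u"
      using ratio_ge[OF assms(1)] \<epsilon>_pos assms(2) by (intro powr_mono2) auto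
    then show "\<epsilon> powr u * (r j i * m j i) powr s \<le> (r j i * m j i) powr (s + u)"
      unfolding add.commute[of s u] powr_add by (rule mult_right_mono) simp
  qed
  show "S (s + u) j \<le> \<delta> powr u * S s j"
    unfolding power_sum_def sum_distrib_left
  proof (rule sum_mono)
    fix i assume i: "i \<in> {1..N j}"
    then have "(r j i * m j i) powr u \<le> \<delta> powr u"
      using ratio_ge[OF assms(1) i] ratio_le[OF assms(1) i] \<epsilon>_pos assms(2) by (intro powr_mono2) auto
    then show "(r j i * m j i) powr (s + u) \<le> \<delta> powr u * (r j i * m j i) powr s"
      unfolding add.commute[of s u] powr_add by (rule mult_right_mono) simp
  qed
qed

lemma S_le: "S s j \<le> real K" if "j \<in> J" "0 \<le> s"
proof -
  have "S s j \<le> \<delta> powr s * S 0 j"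
    using S_shift(2)[OF that, of 0] by simp
  also have "\<dots> \<le> 1 * S 0 j"
    using S_pos[OF that(1), of 0] \<delta>_pos \<delta>_less that(2)
    by (intro mult_right_mono powr_le1) auto
  also have "\<dots> \<le> real K"
    using N_le that S_zero by simp
  finally show ?thesis .
qed

lemma ln_S_slope:
  assumes "j \<in> J" "s \<le> t"
  shows "ln \<epsilon> * (t - s) \<le> ln (S t j) - ln (S s j)" and "ln (S t j) - ln (S s j) \<le> ln \<delta> * (t - s)"
  using S_shift[of j "t - s" s] assms S_pos \<epsilon>_pos \<delta>_pos by (auto intro!: ln_slope)

text \<open>The bound is uniform in \<open>j\<close>, which makes the logarithmic series summable.
  It adds the upper bound \<open>ln K\<close> to the depth \<open>- ln \<epsilon> * s\<close> by
  which the logarithm can drop below its nonnegative value at 0.\<close>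

lemma abs_ln_S_le:
  assumes "j \<in> J" "0 \<le> s"
  shows "\<bar>ln (S s j)\<bar> \<le> ln (real K) - ln \<epsilon> * s"
proof -
  have "0 \<le> ln (S 0 j)"
    using N_ge[OF assms(1)] S_zero[OF assms(1)] by simp
  moreover have "ln (S s j) \<le> ln (real K)"
    using S_le[OF assms] S_pos[OF assms(1)] by (rule ln_mono)
  moreover have "ln \<epsilon> * s \<le> 0"
    using \<epsilon>_pos \<epsilon>_less assms(2) by (intro mult_nonpos_nonneg) auto
  moreover have "0 \<le> ln (real K)"
    using N_ge[OF assms(1)] N_le[OF assms(1)] by simp
  ultimately show ?thesis
    using ln_S_slope(1)[OF assms] by (simp add: abs_le_iff)
qed

section \<open>Averages with respect to the weights\<close>

lemma weighted_summable:
  assumes "\<And>j. j \<in> J \<Longrightarrow> \<bar>f j\<bar> \<le> C"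
  shows "(\<lambda>j. p j * f j) summable_on J"
proof -
  have "(\<lambda>j. norm (p j * f j)) summable_on J"
  proof (rule Infinite_Sum.abs_summable_on_comparison_test')
    show "(\<lambda>j. p j * C) summable_on J"
      using p_sum by (intro summable_on_cmult_left) (auto simp: summable_on_def)
    show "norm (p j * f j) \<le> p j * C" if "j \<in> J" for j
      using assms[OF that] p_nonneg[OF that] by (simp add: abs_mult mult_left_mono)
  qed
  then show ?thesis
    using summable_on_iff_abs_summable_on_real by blast
qed

lemma summable_S: "(\<lambda>j. p j * S s j) summable_on J" if "0 \<le> s"
  using S_le[OF _ that] S_pos by (intro weighted_summable[of _ "real K"]) (auto simp: less_imp_le)

lemma summable_ln_S: "(\<lambda>j. p j * ln (S s j)) summable_on J" if "0 \<le> s"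
  using abs_ln_S_le[OF _ that] by (rule weighted_summable)

text \<open>The weights have total mass 1, so a constant averages to itself. The two comparison
  lemmas that follow are later applied with \<open>k = 1\<close> for logarithms,
  \<open>c = 0\<close> for power sums and \<open>k = 0\<close> for constant lower bounds.\<close>

lemma has_sum_mean_affine:
  assumes "(\<lambda>j. p j * f j) summable_on J"
  shows "((\<lambda>j. p j * (k * f j + c)) has_sum (k * mean f + c)) J"
proof -
  have "((\<lambda>j. k * (p j * f j) + p j * c) has_sum (k * mean f + 1 * c)) J"
    using assms p_sum by (intro has_sum_add has_sum_cmult_right has_sum_cmult_left) auto
  then show ?thesis by (simp add: algebra_simps)
qed

lemma mean_le_affine:
  assumes "(\<lambda>j. p j * f j) summable_on J" "(\<lambda>j. p j * g j) summable_on J"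
    and "\<And>j. j \<in> J \<Longrightarrow> f j \<le> k * g j + c"
  shows "mean f \<le> k * mean g + c"
  using assms p_nonneg
  by (intro has_sum_mono[OF has_sum_infsum has_sum_mean_affine] mult_left_mono)

lemma affine_le_mean:
  assumes "(\<lambda>j. p j * f j) summable_on J" "(\<lambda>j. p j * g j) summable_on J"
    and "\<And>j. j \<in> J \<Longrightarrow> k * g j + c \<le> f j"
  shows "k * mean g + c \<le> mean f"
  using assms p_nonneg
  by (intro has_sum_mono[OF has_sum_mean_affine has_sum_infsum] mult_left_mono)

lemma mean_S_pos: "0 < mean (S s)" if "0 \<le> s"
proof -
  \<comment> \<open>Every power sum has at least two summands, each at least
    \<open>\<epsilon> powr s\<close>; this bound does not depend on \<open>j\<close>.\<close>
  have "0 * mean (S s) + \<epsilon> powr s * 2 \<le> mean (S s)"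
  proof (rule affine_le_mean[OF summable_S summable_S])
    show "0 * S s j + \<epsilon> powr s * 2 \<le> S s j" if "j \<in> J" for j
    proof -
      have "\<epsilon> powr s * 2 \<le> \<epsilon> powr s * S 0 j"
        using N_ge S_zero that by (intro mult_left_mono) auto
      then show ?thesis
        using S_shift(1)[OF that \<open>0 \<le> s\<close>, of 0] by simp
    qed
  qed (use that in auto)
  moreover have "0 < \<epsilon> powr s * 2" using \<epsilon>_pos by simp
  ultimately show ?thesis by linarith
qed

section \<open>Existence and uniqueness of both exponents\<close>

lemma unique_root_mean_ln: "\<exists>!s. 0 < s \<and> mean (\<lambda>j. ln (S s j)) = 0"
proof (rule unique_positive_root)
  fix s t :: real assume st: "0 \<le> s" "s \<le> t"
  have "1 * mean (\<lambda>j. ln (S s j)) + ln \<epsilon> * (t - s) \<le> mean (\<lambda>j. ln (S t j))"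
    using ln_S_slope(1)[OF _ st(2)] st
    by (intro affine_le_mean summable_ln_S) (auto simp: algebra_simps)
  moreover have "mean (\<lambda>j. ln (S t j)) \<le> 1 * mean (\<lambda>j. ln (S s j)) + ln \<delta> * (t - s)"
    using ln_S_slope(2)[OF _ st(2)] st
    by (intro mean_le_affine summable_ln_S) (auto simp: algebra_simps)
  ultimately show "ln \<epsilon> * (t - s) \<le> mean (\<lambda>j. ln (S t j)) - mean (\<lambda>j. ln (S s j)) \<and>
      mean (\<lambda>j. ln (S t j)) - mean (\<lambda>j. ln (S s j)) \<le> ln \<delta> * (t - s)"
    by simp
next
  \<comment> \<open>At exponent 0 the power sum counts the branches, and there are at least
    two.\<close>
  have "0 * mean (\<lambda>j. ln (S 0 j)) + ln 2 \<le> mean (\<lambda>j. ln (S 0 j))"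
    using N_ge S_zero by (intro affine_le_mean summable_ln_S) (auto intro!: ln_mono)
  then show "0 < mean (\<lambda>j. ln (S 0 j))"
    using ln_gt_zero[of "2 :: real"] by linarith
qed (use \<delta>_pos \<delta>_less in simp)

lemma unique_root_mean: "\<exists>!s. 0 < s \<and> mean (S s) = 1"
proof -
  \<comment> \<open>The logarithm is essential: the mean itself decays to 0, so its slopes admit no
    uniform negative upper bound.\<close>
  have "\<exists>!s. 0 < s \<and> ln (mean (S s)) = 0"
  proof (rule unique_positive_root)
    fix s t :: real assume st: "0 \<le> s" "s \<le> t"
    have "\<epsilon> powr (t - s) * mean (S s) + 0 \<le> mean (S t)"
      using S_shift(1)[of _ "t - s" s] st by (intro affine_le_mean summable_S) auto
    moreover have "mean (S t) \<le> \<delta> powr (t - s) * mean (S s) + 0"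
      using S_shift(2)[of _ "t - s" s] st by (intro mean_le_affine summable_S) auto
    ultimately show "ln \<epsilon> * (t - s) \<le> ln (mean (S t)) - ln (mean (S s)) \<and>
        ln (mean (S t)) - ln (mean (S s)) \<le> ln \<delta> * (t - s)"
      using ln_slope mean_S_pos \<epsilon>_pos \<delta>_pos st by auto
  next
    have "0 * mean (S 0) + 2 \<le> mean (S 0)"
      using N_ge S_zero by (intro affine_le_mean summable_S) auto
    then show "0 < ln (mean (S 0))" by simp
  qed (use \<delta>_pos \<delta>_less in simp)
  moreover have "ln (mean (S s)) = 0 \<longleftrightarrow> mean (S s) = 1" if "0 < s" for s
    using mean_S_pos[of s] that by simp
  ultimately show ?thesis by (simp cong: conj_cong)
qed

section \<open>Comparison of the roots and the equality case\<close>

text \<open>The logarithmic mean falls at rate at least \<open>- ln \<delta>\<close>, so beyond a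
  point where it is nonpositive it is strictly negative and has no zero.\<close>

lemma mean_ln_root_le:
  assumes "0 \<le> s" "0 \<le> t" "mean (\<lambda>j. ln (S s j)) = 0" "mean (\<lambda>j. ln (S t j)) \<le> 0"
  shows "s \<le> t"
proof (rule ccontr)
  assume "\<not> s \<le> t"
  have "mean (\<lambda>j. ln (S s j)) \<le> 1 * mean (\<lambda>j. ln (S t j)) + ln \<delta> * (s - t)"
    using ln_S_slope(2)[of _ t s] \<open>\<not> s \<le> t\<close> assms
    by (intro mean_le_affine summable_ln_S) (auto simp: algebra_simps)
  moreover have "ln \<delta> * (s - t) < 0"
    using \<open>\<not> s \<le> t\<close> \<delta>_pos \<delta>_less by (intro mult_neg_pos) auto
  ultimately show False using assms by linarith
qed

lemma mean_ln_le:
  assumes "0 \<le> s"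
  shows "mean (\<lambda>j. ln (S s j)) \<le> mean (S s) - 1"
proof -
  have "mean (\<lambda>j. ln (S s j)) \<le> 1 * mean (S s) + (- 1)"
    using assms ln_le_minus_one[OF S_pos] by (intro mean_le_affine summable_ln_S summable_S) auto
  then show ?thesis by simp
qed

text \<open>The gaps \<open>S s j - 1 - ln (S s j)\<close> are nonnegative and their weighted sum is
  \<open>(1 - 1) - 0\<close>, so each weighted gap vanishes; positive weight then forces equality in
  \<open>ln x \<le> x - 1\<close>.\<close>

lemma S_eq_1_if_means_agree:
  assumes s: "0 \<le> s" and "mean (\<lambda>j. ln (S s j)) = 0" "mean (S s) = 1" and j: "j \<in> J" "0 < p j"
  shows "S s j = 1"
proof -
  have "((\<lambda>j. p j * (1 * S s j + (- 1)) + (- 1) * (p j * ln (S s j))) has_sum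
      ((1 * mean (S s) + (- 1)) + (- 1) * mean (\<lambda>j. ln (S s j)))) J"
    using summable_S[OF s] summable_ln_S[OF s]
    by (intro has_sum_add has_sum_mean_affine has_sum_cmult_right) auto
  then have "((\<lambda>j. p j * (S s j - 1 - ln (S s j))) has_sum 0) J"
    using assms(2,3) by (simp add: algebra_simps)
  moreover have "0 \<le> p j * (S s j - 1 - ln (S s j))" if "j \<in> J" for j
    using ln_le_minus_one[OF S_pos[OF that, of s]] p_nonneg[OF that] by simp
  ultimately have "p j * (S s j - 1 - ln (S s j)) = 0"
    by (rule nonneg_has_sum_le_0D[OF _ order_refl _ j(1)])
  then have "ln (S s j) = S s j - 1"
    using j(2) by simp
  then show ?thesis
    using ln_eq_minus_one S_pos j(1) by blast
qed

text \<open>Indices of probability zero contribute nothing to either mean, which is why only those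
  with \<open>0 < p j\<close> are constrained.\<close>

lemma means_if_S_eq_1:
  assumes "\<And>j. j \<in> J \<Longrightarrow> 0 < p j \<Longrightarrow> S s j = 1"
  shows "mean (\<lambda>j. ln (S s j)) = 0" and "mean (S s) = 1"
proof -
  have pj: "p j = 0 \<or> S s j = 1" if "j \<in> J" for j
    using assms p_nonneg that by fastforce
  show "mean (\<lambda>j. ln (S s j)) = 0"
    using pj by (intro infsum_0) fastforce
  have "mean (S s) = infsum p J"
    using pj by (intro infsum_cong) fastforce
  then show "mean (S s) = 1"
    using p_sum by (simp add: infsumI)
qed

section \<open>Translation of the defining equations into means\<close>

lemma homogeneous_eq_iff: "homogeneous_eq J p N r m s \<longleftrightarrow> mean (\<lambda>j. ln (S s j)) = 0" if "0 < s"
proof -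
  have "homogeneous_eq J p N r m s \<longleftrightarrow> has_unordered_prod (\<lambda>j. exp (p j * ln (S s j))) 1 J"
    unfolding homogeneous_eq_def has_unordered_prod_def
  proof (rule filterlim_cong)
    show "\<forall>\<^sub>F F in finite_subsets_at_top J.
        (\<Prod>j\<in>F. S s j powr p j) = (\<Prod>j\<in>F. exp (p j * ln (S s j)))"
    proof (intro eventually_finite_subsets_at_top_weakI prod.cong refl)
      fix F j assume "F \<subseteq> J" "j \<in> F"
      then show "S s j powr p j = exp (p j * ln (S s j))"
        using S_pos[of j s] by (auto simp: powr_def)
    qed
  qed auto
  also have "\<dots> \<longleftrightarrow> mean (\<lambda>j. ln (S s j)) = 0"
    using summable_ln_S that by (intro has_unordered_prod_exp_iff) auto
  finally show ?thesis .
qed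

lemma recursive_eq_iff:
  assumes "prob_space M" "countable J" "U \<in> measurable M (count_space J)"
    and "\<And>j. j \<in> J \<Longrightarrow> measure M {\<omega> \<in> space M. U \<omega> = j} = p j" and "0 < s"
  shows "recursive_eq M U N r m s \<longleftrightarrow> mean (S s) = 1"
  unfolding recursive_eq_def
  using infsumI[OF prob_space.has_sum_expectation_discrete[OF assms(1-4) summable_S[of s]]] assms(5)
  by simp

end

section \<open>Application to weighted Cantor systems\<close>

theorem proposition4p10:
  fixes a b :: real
    and J :: "'j set"
    and p :: "'j \<Rightarrow> real"
    and N :: "'j \<Rightarrow> nat"
    and r c m :: "'j \<Rightarrow> nat \<Rightarrow> real"
    and M :: "'w measure"
    and U :: "'w \<Rightarrow> 'j"
  assumes "a < b"
    and "countable J" and "J \<noteq> {}"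
    and "\<forall>j\<in>J. 0 \<le> p j" and "(p has_sum 1) J"
    and "\<forall>j\<in>J. cantor_ifs a b (N j) (r j) (c j)"
    and "\<forall>j\<in>J. weight_vector (N j) (m j)"
    and "prob_space M"
    and "U \<in> measurable M (count_space J)"
    and "\<forall>j\<in>J. measure M {\<omega> \<in> space M. U \<omega> = j} = p j"
    and A1: "bdd_above (N ` J)"
    and A2: "(INF j\<in>J. MIN i\<in>{1..N j}. r j i * m j i) > 0"
    and A3: "(SUP j\<in>J. MAX i\<in>{1..N j}. r j i * m j i) < 1"
    and A4: "\<exists>P>0. has_unordered_prod (\<lambda>j. \<Sum>i=1..N j. r j i * m j i) P
                 {j \<in> J. (\<Sum>i=1..N j. r j i * m j i) < 1}"
    and A5: "\<exists>P. has_unordered_prod (\<lambda>j. \<Sum>i=1..N j. r j i * m j i) P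
                 {j \<in> J. (\<Sum>i=1..N j. r j i * m j i) > 1}"
  shows "(\<exists>!s. 0 < s \<and> homogeneous_eq J p N r m s) \<and>
         (\<exists>!s. 0 < s \<and> recursive_eq M U N r m s) \<and>
         gamma_h J p N r m \<le> gamma_r M U N r m \<and>
         (gamma_h J p N r m = gamma_r M U N r m \<longleftrightarrow>
           (\<exists>\<alpha>>0. \<forall>j\<in>J. 0 < p j \<longrightarrow> (\<Sum>i=1..N j. (r j i * m j i) powr \<alpha>) = 1))"
proof -
  define \<epsilon> where "\<epsilon> = (INF j\<in>J. MIN i\<in>{1..N j}. r j i * m j i)"
  define \<delta> where "\<delta> = (SUP j\<in>J. MAX i\<in>{1..N j}. r j i * m j i)"
  have N2: "2 \<le> N j" and r: "\<And>i. i \<in> {1..N j} \<Longrightarrow> 0 < r j i \<and> r j i < 1"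
    and m: "\<And>i. i \<in> {1..N j} \<Longrightarrow> 0 < m j i \<and> m j i < 1" if "j \<in> J" for j
    using assms(6,7) that by (auto simp: cantor_ifs_def weight_vector_def Let_def)
  have ratio: "0 < r j i * m j i \<and> r j i * m j i < 1" if "j \<in> J" "i \<in> {1..N j}" for j i
    using r[OF that] m[OF that] mult_strict_mono[of "r j i" 1 "m j i" 1] by simp
  \<comment> \<open>A real infimum or supremum bounds its family only once boundedness is known;
    ratios in (0,1) supply the bounds 0 and 1, and \<open>2 \<le> N j\<close> keeps the inner
    minimum and maximum over nonempty sets.\<close>
  have "bdd_below ((\<lambda>j. MIN i\<in>{1..N j}. r j i * m j i) ` J)"
  proof (rule bdd_belowI2)
    show "0 \<le> (MIN i\<in>{1..N j}. r j i * m j i)" if "j \<in> J" for j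
      using ratio[OF that] N2[OF that] by (intro Min.boundedI) (auto simp: less_imp_le)
  qed
  then have inf: "\<epsilon> \<le> (MIN i\<in>{1..N j}. r j i * m j i)" if "j \<in> J" for j
    unfolding \<epsilon>_def using that by (rule cINF_lower)
  have "bdd_above ((\<lambda>j. MAX i\<in>{1..N j}. r j i * m j i) ` J)"
  proof (rule bdd_aboveI2)
    show "(MAX i\<in>{1..N j}. r j i * m j i) \<le> 1" if "j \<in> J" for j
      using ratio[OF that] N2[OF that] by (intro Max.boundedI) (auto simp: less_imp_le)
  qed
  then have sup: "(MAX i\<in>{1..N j}. r j i * m j i) \<le> \<delta>" if "j \<in> J" for j
    unfolding \<delta>_def using cSUP_upper[OF that] by blast
  obtain K where K: "\<And>j. j \<in> J \<Longrightarrow> N j \<le> K"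
    using A1 by (auto simp: bdd_above_def)
  interpret bounded_system J p N r m \<epsilon> \<delta> K
  proof
    show "\<epsilon> \<le> r j i * m j i" "r j i * m j i \<le> \<delta>" if "j \<in> J" "i \<in> {1..N j}" for j i
      using order_trans[OF inf[OF that(1)] Min_le] order_trans[OF Max_ge sup[OF that(1)]] that(2)
      by auto
  qed (use assms(4,5) A2 A3 N2 K in \<open>auto simp: \<epsilon>_def \<delta>_def\<close>)
  \<comment> \<open>The conjunct \<open>0 < s\<close> stays on both sides so that these equivalences
    rewrite the bodies of the definite descriptions directly.\<close>
  have h_iff: "0 < s \<and> homogeneous_eq J p N r m s \<longleftrightarrow> 0 < s \<and> mean (\<lambda>j. ln (S s j)) = 0" for s
    using homogeneous_eq_iff by blast
  have r_iff: "0 < s \<and> recursive_eq M U N r m s \<longleftrightarrow> 0 < s \<and> mean (S s) = 1" for s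
    using recursive_eq_iff[OF assms(8,2,9)] assms(10) by blast
  let ?h = "gamma_h J p N r m" and ?r = "gamma_r M U N r m"
  have h: "0 < ?h" "mean (\<lambda>j. ln (S ?h j)) = 0"
    using theI'[OF unique_root_mean_ln] unfolding gamma_h_def h_iff by auto
  have r: "0 < ?r" "mean (S ?r) = 1"
    using theI'[OF unique_root_mean] unfolding gamma_r_def r_iff by auto
  \<comment> \<open>At \<open>?r\<close> the logarithmic mean is at most \<open>1 - 1 = 0\<close>,
    so its zero \<open>?h\<close> cannot lie further right.\<close>
  have le: "?h \<le> ?r"
    using mean_ln_root_le[of ?h ?r] mean_ln_le[of ?r] h r by simp
  have eq: "?h = ?r \<longleftrightarrow> (\<exists>\<alpha>>0. \<forall>j\<in>J. 0 < p j \<longrightarrow> S \<alpha> j = 1)"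
  proof
    assume "?h = ?r"
    \<comment> \<open>The common exponent itself serves as the witness.\<close>
    then show "\<exists>\<alpha>>0. \<forall>j\<in>J. 0 < p j \<longrightarrow> S \<alpha> j = 1"
      using S_eq_1_if_means_agree[of ?r] h r by (intro exI[of _ ?r]) auto
  next
    assume "\<exists>\<alpha>>0. \<forall>j\<in>J. 0 < p j \<longrightarrow> S \<alpha> j = 1"
    then obtain \<alpha> where "0 < \<alpha>" "\<And>j. j \<in> J \<Longrightarrow> 0 < p j \<Longrightarrow> S \<alpha> j = 1" by blast
    \<comment> \<open>Such an \<alpha> solves both mean equations, so by uniqueness it coincides
      with \<open>?h\<close> and with \<open>?r\<close>.\<close>
    then show "?h = ?r"
      using means_if_S_eq_1[of \<alpha>] unique_root_mean_ln unique_root_mean h r by metis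
  qed
  show ?thesis
    using unique_root_mean_ln unique_root_mean le eq
    unfolding h_iff r_iff by (simp add: power_sum_def)
qed

end
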